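(* Let $G$ be a connected graph and $H$ a graph. Then $G\circ H$ has an independent $[1,2]$-set if and only if at least one of the following holds: (1) $G=K_1$ and $H$ has an independent $[1,2]$-set; (2) $G$ has an efficient dominating set and $\gamma_{i[1,2]}(H)\leq 2$; (3) $G$ has an independent $[1,2]$-set and $\gamma_{i[1,2]}(H)=1$.
   Context: All graphs are finite and simple; $N_X(x)$ is the open neighborhood of $x$ in $X$. The lexicographic product $G\circ H$ has vertex set $V(G)\times V(H)$, and $(g,h)$ is adjacent to $(g',h')$ iff either $\{g,g'\}\in E(G)$, or $g=g'$ and $\{h,h'\}\in E(H)$. An independent $[1,2]$-set of a graph $X$ is an independent set $S$ such that every vertex $x\notin S$ satisfies $1\le |N_X(x)\cap S|\le 2$; $\gamma_{i[1,2]}(X)$ is the minimum cardinality of an independent $[1,2]$-set of $X$ (when one exists). An efficient dominating set of $G$ is a set $S$ such that every $v\notin S$ has exactly one neighbor in $S$ and every $v\in S$ has no neighbor in $S$. *)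

theory Defs
  imports "Graph_Theory.Graph_Theory" "HOL-Library.Extended_Nat"
begin

text \<open>
  A finite simple graph is a \<^locale>\<open>pair_graph\<close>: an undirected edge between
  \<open>u\<close> and \<open>v\<close> is the pair of arcs \<open>(u, v)\<close>, \<open>(v, u)\<close>.
\<close>

definition nbhd :: "'a pair_pre_digraph \<Rightarrow> 'a \<Rightarrow> 'a set" where
  "nbhd X x = {y. (x, y) \<in> parcs X}"

definition independent_set :: "'a pair_pre_digraph \<Rightarrow> 'a set \<Rightarrow> bool" where
  "independent_set X S \<longleftrightarrow> S \<subseteq> pverts X \<and> (\<forall>x\<in>S. \<forall>y\<in>S. (x, y) \<notin> parcs X)"

definition indep_12_set :: "'a pair_pre_digraph \<Rightarrow> 'a set \<Rightarrow> bool" where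
  "indep_12_set X S \<longleftrightarrow> independent_set X S \<and>
     (\<forall>x \<in> pverts X - S. 1 \<le> card (nbhd X x \<inter> S) \<and> card (nbhd X x \<inter> S) \<le> 2)"

text \<open>
  The infimum is taken in \<^typ>\<open>enat\<close>, so the number is \<open>\<infinity>\<close> exactly when no
  independent \<open>[1,2]\<close>-set exists; hence a bound by a natural number includes existence.
\<close>

definition gamma_i12 :: "'a pair_pre_digraph \<Rightarrow> enat" where
  "gamma_i12 X = (INF S \<in> {S. indep_12_set X S}. enat (card S))"

lemma gamma_i12_le_iff:
  "gamma_i12 X \<le> enat k \<longleftrightarrow> (\<exists>S. indep_12_set X S \<and> card S \<le> k)"
proof
  assume le: "gamma_i12 X \<le> enat k"
  let ?A = "(\<lambda>S. enat (card S)) ` {S. indep_12_set X S}"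
  have "?A \<noteq> {}"
    using le by (auto simp: gamma_i12_def Inf_enat_def split: if_splits)
  then have "Inf ?A \<in> ?A"
    unfolding Inf_enat_def by (metis (full_types) LeastI ex_in_conv)
  with le show "\<exists>S. indep_12_set X S \<and> card S \<le> k"
    unfolding gamma_i12_def by auto
next
  assume "\<exists>S. indep_12_set X S \<and> card S \<le> k"
  then obtain S where "indep_12_set X S" "card S \<le> k" by blast
  then show "gamma_i12 X \<le> enat k"
    unfolding gamma_i12_def by (intro INF_lower2[of S]) auto
qed

definition efficient_dominating_set :: "'a pair_pre_digraph \<Rightarrow> 'a set \<Rightarrow> bool" where
  "efficient_dominating_set G S \<longleftrightarrow> S \<subseteq> pverts G \<and>
     (\<forall>v \<in> pverts G - S. card (nbhd G v \<inter> S) = 1) \<and>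
     (\<forall>v \<in> S. nbhd G v \<inter> S = {})"

definition lex_product ::
  "'a pair_pre_digraph \<Rightarrow> 'b pair_pre_digraph \<Rightarrow> ('a \<times> 'b) pair_pre_digraph" where
  "lex_product G H = \<lparr>
     pverts = pverts G \<times> pverts H,
     parcs = {((g, h), (g', h')) | g h g' h'.
       (g, h) \<in> pverts G \<times> pverts H \<and> (g', h') \<in> pverts G \<times> pverts H \<and>
       ((g, g') \<in> parcs G \<or> g = g' \<and> (h, h') \<in> parcs H)} \<rparr>"

lemma pair_graph_lex_product:
  assumes "pair_graph G" "pair_graph H"
  shows "pair_graph (lex_product G H)"
proof -
  interpret G: pair_graph G by fact
  interpret H: pair_graph H by fact
  have fin: "finite (pverts G \<times> pverts H)"
    using G.pair_finite_verts H.pair_finite_verts by simp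
  have "parcs (lex_product G H) \<subseteq> (pverts G \<times> pverts H) \<times> (pverts G \<times> pverts H)"
    by (auto simp: lex_product_def)
  then have "finite (parcs (lex_product G H))"
    using fin by (meson finite_SigmaI finite_subset)
  moreover have "symmetric (with_proj (lex_product G H))"
    using G.pair_sym_arcs H.pair_sym_arcs
    by (auto simp: symmetric_def lex_product_def sym_def)
  ultimately show ?thesis
    using fin
    by unfold_locales (auto simp: lex_product_def dest: G.no_loops' H.no_loops')
qed

end

theory Submission
  imports Defs
begin

text \<open>
  Let \<open>S\<close> be an independent \<open>[1,2]\<close>-set of \<open>G \<circ> H\<close> and \<open>D\<close> its projection to \<open>G\<close>. Then \<open>D\<close> is
  independent, so a vertex in the copy of \<open>H\<close> over \<open>g \<in> D\<close> can be dominated only from that copy: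
  each nonempty fibre of \<open>S\<close> is an independent \<open>[1,2]\<close>-set of \<open>H\<close>. A vertex over \<open>g \<notin> D\<close> sees
  exactly the union of the fibres over the neighbours of \<open>g\<close>, and this union has size 1 or 2. If
  \<open>G \<noteq> K\<^sub>1\<close>, every \<open>g \<in> D\<close> has a neighbour, which lies outside \<open>D\<close>, so the fibres have size at most 2.
  Either \<open>H\<close> has a dominating vertex and \<open>D\<close> is an independent \<open>[1,2]\<close>-set, or all nonempty fibres
  have size exactly 2 and then \<open>D\<close> is efficient. Conversely one takes products \<open>D \<times> T\<close>.
\<close>

lemma indep_12_set_subset: "indep_12_set X S \<Longrightarrow> S \<subseteq> pverts X"
  by (auto simp: indep_12_set_def independent_set_def)

lemma card_nbhd_indep_12_set:
  assumes "indep_12_set X S" "x \<in> pverts X" "x \<notin> S"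
  shows "card (nbhd X x \<inter> S) \<in> {1, 2}"
proof -
  have "1 \<le> card (nbhd X x \<inter> S)" "card (nbhd X x \<inter> S) \<le> 2"
    using assms by (auto simp: indep_12_set_def)
  then show ?thesis by auto
qed

lemma indep_12_set_nonempty:
  assumes "indep_12_set X S" "pverts X \<noteq> {}"
  shows "S \<noteq> {}"
  using assms by (fastforce simp: indep_12_set_def)

lemma card_indep_12_set_pos:
  assumes "indep_12_set X S" "finite (pverts X)" "pverts X \<noteq> {}"
  shows "0 < card S"
  using assms indep_12_set_nonempty indep_12_set_subset
  by (metis card_gt_0_iff finite_subset)

text \<open>The empty set leaves every vertex undominated, so on a nonempty graph the value 0 cannot
  occur and a bound by 1 already gives equality.\<close>

lemma gamma_i12_eq_1_iff:
  assumes "finite (pverts X)" "pverts X \<noteq> {}"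
  shows "gamma_i12 X = 1 \<longleftrightarrow> (\<exists>S. indep_12_set X S \<and> card S = 1)"
proof -
  have "\<not> gamma_i12 X \<le> enat 0"
    unfolding gamma_i12_le_iff using card_indep_12_set_pos[OF _ assms] by fastforce
  then have "gamma_i12 X = 1 \<longleftrightarrow> gamma_i12 X \<le> enat 1"
    by (metis iless_eSuc0 one_eSuc one_enat_def order_le_less zero_enat_def order_refl)
  also have "\<dots> \<longleftrightarrow> (\<exists>S. indep_12_set X S \<and> card S = 1)"
    unfolding gamma_i12_le_iff using card_indep_12_set_pos[OF _ assms]
    by (metis One_nat_def Suc_leI le_antisym order_refl)
  finally show ?thesis .
qed

text \<open>Separates what \<open>(g, h)\<close> sees in other fibres from what it sees in its own.
  If \<open>Domain S\<close> is independent, exactly one part can matter: the first vanishes for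
  \<open>g\<close> in \<open>Domain S\<close>, the second for \<open>g\<close> outside it. Both
  directions of the theorem rest on this split.\<close>

lemma nbhd_lex_product_Int:
  assumes "S \<subseteq> pverts G \<times> pverts H" "g \<in> pverts G" "h \<in> pverts H"
  shows "nbhd (lex_product G H) (g, h) \<inter> S =
    (SIGMA g':nbhd G g \<inter> Domain S. S `` {g'}) \<union> {g} \<times> (nbhd H h \<inter> S `` {g})"
  using assms by (auto simp: nbhd_def lex_product_def)

lemma independent_set_nbhd: "independent_set X S \<Longrightarrow> x \<in> S \<Longrightarrow> nbhd X x \<inter> S = {}"
  by (auto simp: independent_set_def nbhd_def)

lemma efficient_dominating_set_iff:
  "efficient_dominating_set G D \<longleftrightarrow>
    independent_set G D \<and> (\<forall>g \<in> pverts G - D. card (nbhd G g \<inter> D) = 1)"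
  by (auto simp: efficient_dominating_set_def independent_set_def nbhd_def)

text \<open>A vertex over \<open>D\<close> sees only the copy of \<open>T\<close> in its own fibre;
  any other vertex sees one full copy of \<open>T\<close> for each neighbour in \<open>D\<close>,
  hence the product in the third assumption. This form serves all three cases of the
  converse.\<close>

lemma indep_12_set_Times:
  assumes D: "independent_set G D" and T: "indep_12_set H T"
    and *: "\<And>g. g \<in> pverts G - D \<Longrightarrow> card (nbhd G g \<inter> D) * card T \<in> {1, 2}"
  shows "indep_12_set (lex_product G H) (D \<times> T)"
proof -
  have sub: "D \<times> T \<subseteq> pverts G \<times> pverts H"
    using D indep_12_set_subset[OF T] by (auto simp: independent_set_def)
  have "card (nbhd (lex_product G H) (g, h) \<inter> D \<times> T) \<in> {1, 2}"
    if g: "g \<in> pverts G" and h: "h \<in> pverts H" and gh: "(g, h) \<notin> D \<times> T" for g h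
  proof (cases "g \<in> D")
    case True
    then have "nbhd (lex_product G H) (g, h) \<inter> D \<times> T = {g} \<times> (nbhd H h \<inter> T)"
      using g h independent_set_nbhd[OF D] by (auto simp: nbhd_lex_product_Int[OF sub])
    moreover have "card (nbhd H h \<inter> T) \<in> {1, 2}"
      using card_nbhd_indep_12_set[OF T h] gh True by simp
    ultimately show ?thesis
      by (simp add: card_cartesian_product)
  next
    case False
    then have "nbhd (lex_product G H) (g, h) \<inter> D \<times> T = (nbhd G g \<inter> D) \<times> T"
      using g h by (auto simp: nbhd_lex_product_Int[OF sub])
    with False g * show ?thesis
      by (simp add: card_cartesian_product)
  qed
  then have "1 \<le> card (nbhd (lex_product G H) x \<inter> D \<times> T) \<and>
      card (nbhd (lex_product G H) x \<inter> D \<times> T) \<le> 2"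
    if "x \<in> pverts (lex_product G H) - D \<times> T" for x
    using that by (cases x) (fastforce simp: lex_product_def)
  moreover have "independent_set (lex_product G H) (D \<times> T)"
    using D T sub by (auto simp: indep_12_set_def independent_set_def lex_product_def)
  ultimately show ?thesis
    by (auto simp: indep_12_set_def)
qed

lemma indep_12_set_lex_product_subset:
  "indep_12_set (lex_product G H) S \<Longrightarrow> S \<subseteq> pverts G \<times> pverts H"
  by (auto dest!: indep_12_set_subset simp: lex_product_def)

text \<open>An arc of \<open>G\<close> joins every vertex of one fibre to every vertex of the other,
  so an arc inside \<open>Domain S\<close> would lift to an arc inside \<open>S\<close>.\<close>

lemma independent_set_Domain:
  assumes "indep_12_set (lex_product G H) S"
  shows "independent_set G (Domain S)"
  using assms unfolding indep_12_set_def independent_set_def lex_product_def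
  by simp blast

lemma indep_12_set_fibre:
  assumes S: "indep_12_set (lex_product G H) S" and g: "g \<in> Domain S"
  shows "indep_12_set H (S `` {g})"
proof -
  note sub = indep_12_set_lex_product_subset[OF S]
  have gG: "g \<in> pverts G"
    using sub g by auto
  have "independent_set H (S `` {g})"
    using S gG unfolding indep_12_set_def independent_set_def lex_product_def
    by simp blast
  moreover have "1 \<le> card (nbhd H h \<inter> S `` {g}) \<and> card (nbhd H h \<inter> S `` {g}) \<le> 2"
    if h: "h \<in> pverts H - S `` {g}" for h
  proof -
    have "nbhd (lex_product G H) (g, h) \<inter> S = {g} \<times> (nbhd H h \<inter> S `` {g})"
      using gG h independent_set_nbhd[OF independent_set_Domain[OF S] g]
      by (simp add: nbhd_lex_product_Int[OF sub])
    moreover have "(g, h) \<in> pverts (lex_product G H)" "(g, h) \<notin> S"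
      using gG h by (auto simp: lex_product_def)
    note card_nbhd_indep_12_set[OF S this]
    ultimately show ?thesis
      by (auto simp: card_cartesian_product)
  qed
  ultimately show ?thesis
    by (auto simp: indep_12_set_def)
qed

lemma sum_card_fibres:
  assumes S: "indep_12_set (lex_product G H) S"
    and fin: "finite (pverts G)" "finite (pverts H)" and ne: "pverts H \<noteq> {}"
    and g: "g \<in> pverts G - Domain S"
  shows "(\<Sum>g' \<in> nbhd G g \<inter> Domain S. card (S `` {g'})) \<in> {1, 2}"
proof -
  note sub = indep_12_set_lex_product_subset[OF S]
  \<comment> \<open>Any \<open>h\<close> will do: with no element of \<open>S\<close> over
    \<open>g\<close>, the part of \<open>S\<close> seen from \<open>(g, h)\<close> does not depend
    on \<open>h\<close>.\<close>
  obtain h where h: "h \<in> pverts H"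
    using ne by blast
  have finS: "finite S"
    using sub fin by (meson finite_SigmaI finite_subset)
  have "nbhd (lex_product G H) (g, h) \<inter> S = (SIGMA g':nbhd G g \<inter> Domain S. S `` {g'})"
    using g h by (auto simp: nbhd_lex_product_Int[OF sub])
  then have "card (nbhd (lex_product G H) (g, h) \<inter> S) =
      (\<Sum>g' \<in> nbhd G g \<inter> Domain S. card (S `` {g'}))"
    using finS by (simp add: card_SigmaI finite_Domain)
  moreover have "(g, h) \<in> pverts (lex_product G H)" "(g, h) \<notin> S"
    using g h by (auto simp: lex_product_def)
  note card_nbhd_indep_12_set[OF S this]
  ultimately show ?thesis by simp
qed

text \<open>A loopless graph on one vertex is \<open>K_1\<close>, so here a second vertex exists,
  and a walk from \<open>g\<close> to it begins with an arc at \<open>g\<close>.\<close>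

lemma connected_has_nbhd:
  assumes G: "pair_graph G" and conn: "connected (with_proj G)"
    and nK1: "\<not> complete_digraph 1 (with_proj G)" and g: "g \<in> pverts G"
  obtains g' where "(g, g') \<in> parcs G"
proof -
  interpret pair_graph G by fact
  have "pverts G \<noteq> {g}"
  proof
    assume "pverts G = {g}"
    moreover from this have "parcs G = {}"
      using no_loops' in_arcsD1 in_arcsD2 by fastforce
    ultimately have "complete_digraph 1 (with_proj G)"
      using graph_axioms by (auto simp: complete_digraph_def)
    with nK1 show False by simp
  qed
  then obtain v where v: "v \<in> pverts G" "v \<noteq> g"
    using g by blast
  have "strongly_connected (with_proj G)"
    using conn pair_sym_arcs by (rule symmetric_connected_imp_strongly_connected[rotated])
  then have "g \<rightarrow>\<^sup>*\<^bsub>with_proj G\<^esub> v"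
    using g v by (auto simp: strongly_connected_def)
  then show ?thesis
    using v that by (cases rule: converse_reachable_cases) auto
qed

theorem theorem4p13:
  fixes G :: "'a pair_pre_digraph" and H :: "'b pair_pre_digraph"
  assumes "pair_graph G" and "connected (with_proj G)"
    and "pair_graph H" and "pverts H \<noteq> {}"
  shows "(\<exists>S. indep_12_set (lex_product G H) S) \<longleftrightarrow>
      (complete_digraph 1 (with_proj G) \<and> (\<exists>S. indep_12_set H S)) \<or>
      ((\<exists>S. efficient_dominating_set G S) \<and> gamma_i12 H \<le> 2) \<or>
      ((\<exists>S. indep_12_set G S) \<and> gamma_i12 H = 1)"
proof -
  interpret G: pair_graph G by fact
  interpret H: pair_graph H by fact
  note finG = G.pair_finite_verts and finH = H.pair_finite_verts
  note neH = \<open>pverts H \<noteq> {}\<close>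
  \<comment> \<open>Connectedness in the library includes that there is a vertex.\<close>
  have neG: "pverts G \<noteq> {}"
    using \<open>connected (with_proj G)\<close>
    by (auto simp: connected_def strongly_connected_def mk_symmetric_def)
  note gamma1 = gamma_i12_eq_1_iff[OF finH neH]
  have gamma2: "gamma_i12 H \<le> 2 \<longleftrightarrow> (\<exists>T. indep_12_set H T \<and> card T \<le> 2)"
    using gamma_i12_le_iff[of H 2] by (simp add: numeral_eq_enat)
  show ?thesis (is "?L \<longleftrightarrow> ?K1 \<or> ?E \<or> ?I")
  proof
    assume ?L
    then obtain S where S: "indep_12_set (lex_product G H) S" ..
    define D where "D = Domain S"
    have D: "independent_set G D"
      unfolding D_def by (rule independent_set_Domain[OF S])
    have DG: "D \<subseteq> pverts G"
      using D by (simp add: independent_set_def)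
    then have finD: "finite D"
      using finG by (rule finite_subset)
    have fibre: "indep_12_set H (S `` {g})" if "g \<in> D" for g
      using indep_12_set_fibre[OF S] that by (simp add: D_def)
    have pos: "1 \<le> card (S `` {g})" if "g \<in> D" for g
      using card_indep_12_set_pos[OF fibre[OF that] finH neH] by simp
    have sum: "(\<Sum>g' \<in> nbhd G g \<inter> D. card (S `` {g'})) \<in> {1, 2}" if "g \<in> pverts G - D" for g
      using sum_card_fibres[OF S finG finH neH] that by (simp add: D_def)
    have "S \<noteq> {}"
      using indep_12_set_nonempty[OF S] neG neH by (simp add: lex_product_def)
    then obtain g\<^sub>0 where g\<^sub>0: "g\<^sub>0 \<in> D"
      by (auto simp: D_def)
    show "?K1 \<or> ?E \<or> ?I"
    proof (cases "complete_digraph 1 (with_proj G)")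
      case True
      then show ?thesis using fibre[OF g\<^sub>0] by blast
    next
      case False
      have le2: "card (S `` {g}) \<le> 2" if g: "g \<in> D" for g
      proof -
        obtain g' where g': "(g, g') \<in> parcs G"
          using connected_has_nbhd[OF assms(1,2) False] g DG by blast
        then have g'D: "g' \<in> pverts G - D"
          using D g G.in_arcsD2 by (auto simp: independent_set_def)
        have "g \<in> nbhd G g' \<inter> D"
          using g' g G.pair_sym_arcs by (auto simp: nbhd_def symmetric_def sym_def)
        \<comment> \<open>The fibre over \<open>g\<close> is one summand of the sum at
          \<open>g'\<close>, which is at most 2.\<close>
        then have "card (S `` {g}) \<le> (\<Sum>g' \<in> nbhd G g' \<inter> D. card (S `` {g'}))"
          using finD by (intro member_le_sum) auto
        with sum[OF g'D] show ?thesis by auto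
      qed
      show ?thesis
      proof (cases "gamma_i12 H = 1")
        case True
        have "1 \<le> card (nbhd G g \<inter> D) \<and> card (nbhd G g \<inter> D) \<le> 2" if g: "g \<in> pverts G - D" for g
        proof -
          \<comment> \<open>Every summand is at least 1, so the sum bounds the number of neighbours
            in \<open>D\<close>.\<close>
          have "card (nbhd G g \<inter> D) \<le> (\<Sum>g' \<in> nbhd G g \<inter> D. card (S `` {g'}))"
            using sum_mono[of "nbhd G g \<inter> D" "\<lambda>_. 1" "\<lambda>g'. card (S `` {g'})"] pos by simp
          moreover have "nbhd G g \<inter> D \<noteq> {}"
            using sum[OF g] by auto
          then have "0 < card (nbhd G g \<inter> D)"
            using finD by (simp add: card_gt_0_iff)
          ultimately show ?thesis
            using sum[OF g] by auto
        qed
        with D True show ?thesis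
          by (auto simp: indep_12_set_def)
      next
        case False
        \<comment> \<open>A fibre of size 1 would force \<open>gamma_i12 H = 1\<close>.\<close>
        have eq2: "card (S `` {g}) = 2" if g: "g \<in> D" for g
          using pos[OF g] le2[OF g] False fibre[OF g] gamma1
          by (metis One_nat_def Suc_1 le_SucE le_antisym)
        have "card (nbhd G g \<inter> D) = 1" if g: "g \<in> pverts G - D" for g
        proof -
          have "(\<Sum>g' \<in> nbhd G g \<inter> D. card (S `` {g'})) = card (nbhd G g \<inter> D) * 2"
            using eq2 by simp
          then have "card (nbhd G g \<inter> D) * 2 \<in> {1, 2}"
            using sum[OF g] by simp
          then show ?thesis by auto
        qed
        then have "efficient_dominating_set G D"
          using D by (simp add: efficient_dominating_set_iff)
        with fibre[OF g\<^sub>0] le2[OF g\<^sub>0] show ?thesis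
          unfolding gamma2 by blast
      qed
    qed
  next
    assume "?K1 \<or> ?E \<or> ?I"
    then consider (K1) ?K1 | (E) ?E | (I) ?I by blast
    then show ?L
    proof cases
      case K1
      then obtain T where T: "indep_12_set H T" by blast
      obtain g where "pverts G = {g}"
        using K1 by (auto simp: complete_digraph_def card_1_singleton_iff)
      \<comment> \<open>With \<open>D\<close> the whole vertex set, no vertex lies outside
        \<open>D\<close> and the counting condition is vacuous.\<close>
      then have "independent_set G (pverts G)"
        using G.no_loops' by (auto simp: independent_set_def)
      from indep_12_set_Times[OF this T] show ?thesis by blast
    next
      case E
      then obtain D T where D: "efficient_dominating_set G D"
        and T: "indep_12_set H T" "card T \<le> 2"
        unfolding gamma2 by blast
      have "card T \<in> {1, 2}"
        using T card_indep_12_set_pos[OF T(1) finH neH] by auto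
      with D have "indep_12_set (lex_product G H) (D \<times> T)"
        by (intro indep_12_set_Times[OF _ T(1)]) (auto simp: efficient_dominating_set_iff)
      then show ?thesis by blast
    next
      case I
      then obtain D T where D: "indep_12_set G D" and T: "indep_12_set H T" "card T = 1"
        unfolding gamma1 by blast
      from D have "card (nbhd G g \<inter> D) * card T \<in> {1, 2}" if "g \<in> pverts G - D" for g
        using card_nbhd_indep_12_set[OF D] that T(2) by simp
      with D have "indep_12_set (lex_product G H) (D \<times> T)"
        by (intro indep_12_set_Times[OF _ T(1)]) (auto simp: indep_12_set_def)
      then show ?thesis by blast
    qed
  qed
qed

end
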